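(* Let $\Delta^\ast=\{z\in\mathbb{C}:0<|z|<1\}$ be the punctured unit disk, and let $m_{\Delta^\ast}=s_{\Delta^\ast}/e_{\Delta^\ast}$ be the quotient of its squeezing function by its Fridman invariant. Then there exists $\delta>0$ such that $$m_{\Delta^\ast}(z)<1\quad\text{for all } z \text{ with } 0<|z|<\delta.$$ Moreover, $\lim_{z\to0}m_{\Delta^\ast}(z)=0$.
   Context: $\Delta=\{z\in\mathbb{C}:|z|<1\}$ and $r\Delta=\{z\in\mathbb{C}:|z|<r\}$. For domains $D_1,D_2\subset\mathbb{C}$, $\mathcal{O}_u(D_1,D_2)$ is the set of injective holomorphic maps $D_1\to D_2$. $k_D$ is the Kobayashi (pseudo)distance on a domain $D$, normalized so that $k_\Delta(0,z)=\operatorname{artanh}|z|$: $k_D(z,w)$ is the infimum of $\sum_{j=1}^N k_\Delta(a_j,b_j)$ over all chains of holomorphic maps $f_j:\Delta\to D$ with $f_1(a_1)=z$, $f_j(b_j)=f_{j+1}(a_{j+1})$, $f_N(b_N)=w$. For $z\in D$, $r>0$, let $B_D^k(z,r)=\{w\in D:k_D(z,w)<r\}$. For a bounded domain $D\subset\mathbb{C}$ and $z\in D$, the Fridman invariant is $$e_D(z)=\sup\{\tanh(r): r>0,\ B_D^k(z,r)\subset f(\Delta)\text{ for some } f\in\mathcal{O}_u(\Delta,D)\text{ with } f(0)=z\},$$ the squeezing function is $$s_D(z)=\sup\{r>0: r\Delta\subset f(D)\text{ for some } f\in\mathcal{O}_u(D,\Delta)\text{ with } f(z)=0\},$$ both take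 values in $(0,1]$, and $m_D(z)=s_D(z)/e_D(z)$. *)

theory Defs
  imports "HOL-Complex_Analysis.Complex_Analysis"
begin

abbreviation unit_disc :: "complex set" where
  "unit_disc \<equiv> ball 0 1"

definition punctured_disc :: "complex set" where
  "punctured_disc = {z. 0 < norm z \<and> norm z < 1}"

definition univalent_maps :: "complex set \<Rightarrow> complex set \<Rightarrow> (complex \<Rightarrow> complex) set" where
  "univalent_maps D1 D2 = {f. f holomorphic_on D1 \<and> inj_on f D1 \<and> f ` D1 \<subseteq> D2}"

text \<open>The Poincare distance on the unit disc: the distance invariant under disc automorphisms
  with value \<open>artanh (norm z)\<close> at the pair \<open>0, z\<close>.\<close>

definition poincare_dist :: "complex \<Rightarrow> complex \<Rightarrow> real" where
  "poincare_dist a b = artanh (norm ((a - b) / (1 - cnj b * a)))"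

definition disc_chain ::
  "complex set \<Rightarrow> complex \<Rightarrow> complex \<Rightarrow> nat \<Rightarrow> (nat \<Rightarrow> complex \<Rightarrow> complex) \<Rightarrow>
    (nat \<Rightarrow> complex) \<Rightarrow> (nat \<Rightarrow> complex) \<Rightarrow> bool" where
  "disc_chain D z w N f a b \<longleftrightarrow>
     N \<ge> 1 \<and>
     (\<forall>j\<in>{1..N}. f j holomorphic_on unit_disc \<and> f j ` unit_disc \<subseteq> D \<and>
        a j \<in> unit_disc \<and> b j \<in> unit_disc) \<and>
     f 1 (a 1) = z \<and>
     (\<forall>j\<in>{1..<N}. f j (b j) = f (j + 1) (a (j + 1))) \<and>
     f N (b N) = w"

text \<open>The infimum is over a nonempty set of nonnegative reals when \<open>D\<close> is open and connected
  and \<open>z\<close>, \<open>w\<close> lie in \<open>D\<close>; otherwise the value may be unspecified.\<close>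

definition kobayashi_dist :: "complex set \<Rightarrow> complex \<Rightarrow> complex \<Rightarrow> real" where
  "kobayashi_dist D z w =
     Inf {(\<Sum>j=1..N. poincare_dist (a j) (b j)) |N f a b. disc_chain D z w N f a b}"

definition kobayashi_ball :: "complex set \<Rightarrow> complex \<Rightarrow> real \<Rightarrow> complex set" where
  "kobayashi_ball D z r = {w \<in> D. kobayashi_dist D z w < r}"

text \<open>For a bounded domain \<open>D\<close> and \<open>z\<close> in \<open>D\<close>, the two suprema below are over nonempty
  sets of reals in \<open>(0, 1]\<close>.\<close>

definition fridman_invariant :: "complex set \<Rightarrow> complex \<Rightarrow> real" where
  "fridman_invariant D z =
     Sup {tanh r |r. r > 0 \<and>
       (\<exists>f\<in>univalent_maps unit_disc D. f 0 = z \<and> kobayashi_ball D z r \<subseteq> f ` unit_disc)}"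

definition squeezing_function :: "complex set \<Rightarrow> complex \<Rightarrow> real" where
  "squeezing_function D z =
     Sup {r. r > 0 \<and> (\<exists>f\<in>univalent_maps D unit_disc. f z = 0 \<and> ball 0 r \<subseteq> f ` D)}"

definition quotient_invariant :: "complex set \<Rightarrow> complex \<Rightarrow> real" where
  "quotient_invariant D z = squeezing_function D z / fridman_invariant D z"

end

theory Submission
  imports Defs "HOL-Real_Asymp.Real_Asymp"
begin

text \<open>The quotient is squeezed between \<open>0\<close> and \<open>L * norm z\<close>, where \<open>L = - ln (norm z)\<close>.
  A univalent map of the punctured disc into the disc that vanishes at \<open>z\<close> extends over the
  puncture, and the value of the extension at \<open>0\<close> is omitted by the map; by the Schwarz-Pick
  inequality this value has modulus at most \<open>norm z\<close>, so the squeezing function is at most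
  \<open>norm z\<close>. On the other hand, lifting chains of discs through the universal covering
  \<open>\<phi>\<close> with \<open>\<phi> 0 = z\<close> shows that the Kobayashi ball of radius \<open>r\<close> around \<open>z\<close> is contained in
  the image under \<open>\<phi>\<close> of the disc of radius \<open>tanh r\<close>. As \<open>\<phi>\<close> is injective on the disc of radius
  \<open>1 / L\<close>, the Fridman invariant is at least \<open>1 / L\<close>.\<close>

section \<open>The Poincare distance\<close>

lemma poincare_dist_Moebius: "poincare_dist a b = artanh (norm (Moebius_function 0 b a))"
  by (simp add: poincare_dist_def Moebius_function_simple)

text \<open>Moebius maps on both sides move \<open>b\<close> and \<open>f b\<close> to
  \<open>0\<close>. The conjugated map \<open>F\<close> then fixes the origin, and the Schwarz lemma
  applies at the image \<open>u\<close> of \<open>a\<close>.\<close>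

lemma Schwarz_Pick:
  assumes holf: "f holomorphic_on unit_disc" and f: "f ` unit_disc \<subseteq> unit_disc"
    and a: "norm a < 1" and b: "norm b < 1"
  shows "norm (Moebius_function 0 (f b) (f a)) \<le> norm (Moebius_function 0 b a)"
proof -
  have nf: "norm (f x) < 1" if "norm x < 1" for x
    using f that by (auto simp: image_subset_iff)
  define F where "F = Moebius_function 0 (f b) \<circ> f \<circ> Moebius_function 0 (- b)"
  define u where "u = Moebius_function 0 b a"
  have nM: "norm (Moebius_function 0 (- b) x) < 1" if "norm x < 1" for x
    using Moebius_function_norm_lt_1[of "- b" x] b that by simp
  have "F holomorphic_on ball 0 1"
    unfolding F_def
    by (intro holomorphic_on_compose_gen[of _ _ _ "ball 0 1"] Moebius_function_holomorphic holf nf b)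
      (use nM nf b in auto)
  moreover have "F 0 = 0"
    by (simp add: F_def Moebius_function_of_zero Moebius_function_eq_zero)
  moreover have "norm (F x) < 1" if "norm x < 1" for x
    using that by (simp add: F_def nM nf b Moebius_function_norm_lt_1)
  moreover have "norm u < 1"
    unfolding u_def by (intro Moebius_function_norm_lt_1 a b)
  ultimately have "norm (F u) \<le> norm u"
    by (rule Schwarz_Lemma(1))
  moreover have "Moebius_function 0 (- b) u = a"
    unfolding u_def using Moebius_function_compose[of "- b" b a] a b by simp
  ultimately show ?thesis
    by (simp add: F_def u_def)
qed

lemma artanh_real_mono:
  fixes x y :: real
  assumes "-1 < x" "x \<le> y" "y < 1"
  shows "artanh x \<le> artanh y"
proof -
  have "(1 + x) / (1 - x) \<le> (1 + y) / (1 - y)"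
    using assms by (intro frac_le) auto
  then show ?thesis
    using assms by (simp add: artanh_def)
qed

lemma tanh_artanh_real:
  fixes x :: real
  assumes "-1 < x" "x < 1"
  shows "tanh (artanh x) = x"
proof -
  have "0 < (1 + x) / (1 - x)"
    using assms by auto
  moreover have "- 2 * artanh x = - ln ((1 + x) / (1 - x))"
    by (simp add: artanh_def)
  ultimately have "exp (- 2 * artanh x) = (1 - x) / (1 + x)"
    by (simp add: exp_minus)
  then have "tanh (artanh x) = (1 - (1 - x) / (1 + x)) / (1 + (1 - x) / (1 + x))"
    by (simp only: tanh_real_altdef)
  also have "\<dots> = x"
    using assms by (simp add: divide_simps)
  finally show ?thesis .
qed

text \<open>Twice \<open>artanh t\<close> is the logarithm of \<open>(1 + t) / (1 - t)\<close>, and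
  this fraction is multiplicative under the velocity addition on the right-hand side.\<close>

lemma artanh_add_real:
  fixes x y :: real
  assumes "0 \<le> x" "x < 1" "0 \<le> y" "y < 1"
  shows "artanh x + artanh y = artanh ((x + y) / (1 + x * y))"
proof -
  have "1 + x * y > 0"
    using assms by (simp add: add_pos_nonneg)
  \<comment> \<open>Expanded, this says \<open>x + y < 1 + x * y\<close>, so the combined argument
    stays below 1.\<close>
  moreover have "0 < (1 - x) * (1 - y)"
    using assms by simp
  then have "1 + x * y \<noteq> x + y"
    by (simp add: algebra_simps)
  ultimately have "(1 + x) / (1 - x) * ((1 + y) / (1 - y)) =
      (1 + (x + y) / (1 + x * y)) / (1 - (x + y) / (1 + x * y))"
    using assms by (simp add: divide_simps) (simp add: algebra_simps)
  moreover have "ln ((1 + x) / (1 - x) * ((1 + y) / (1 - y))) =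
      ln ((1 + x) / (1 - x)) + ln ((1 + y) / (1 - y))"
    using assms by (intro ln_mult_pos) auto
  ultimately show ?thesis
    by (simp add: artanh_def)
qed

text \<open>The numerator depends only on the moduli of \<open>w\<close> and \<open>z\<close>; their
  relative argument enters through the denominator alone. Extremal estimates thus reduce to bounding
  \<open>norm (1 - cnj w * z)\<close>.\<close>

lemma one_minus_norm_Moebius_square:
  assumes "norm w < 1" "norm z < 1"
  shows "1 - (norm (Moebius_function 0 w z))\<^sup>2 =
    (1 - (norm w)\<^sup>2) * (1 - (norm z)\<^sup>2) / (norm (1 - cnj w * z))\<^sup>2"
proof -
  have "norm (cnj w * z) < 1"
    using norm_mult_less[of "cnj w" 1 z 1] assms by simp
  then have "1 - cnj w * z \<noteq> 0"
    by (metis norm_one less_irrefl right_minus_eq)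
  moreover have "(norm (1 - cnj w * z))\<^sup>2 - (norm (z - w))\<^sup>2 = (1 - (norm w)\<^sup>2) * (1 - (norm z)\<^sup>2)"
    by (simp add: cmod_power2) (simp add: power2_eq_square algebra_simps)
  ultimately show ?thesis
    by (simp add: Moebius_function_simple norm_divide power_divide field_simps)
qed

text \<open>The worst case is \<open>w\<close> and \<open>z\<close> pointing in opposite directions,
  where the denominator of the preceding identity reaches its maximum
  \<open>1 + norm w * norm z\<close>.\<close>

lemma norm_Moebius_le:
  assumes w: "norm w < 1" and z: "norm z < 1"
  shows "norm (Moebius_function 0 w z) \<le> (norm w + norm z) / (1 + norm w * norm z)"
proof -
  define x where "x = norm w"
  define y where "y = norm z"
  have xy: "0 \<le> x" "x < 1" "0 \<le> y" "y < 1"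
    using w z by (auto simp: x_def y_def)
  have "norm (cnj w * z) < 1"
    using norm_mult_less[of "cnj w" 1 z 1] assms by simp
  then have ne: "1 - cnj w * z \<noteq> 0"
    by (metis norm_one less_irrefl right_minus_eq)
  have pos: "1 + x * y > 0"
    using xy by (simp add: add_pos_nonneg)
  have "norm (1 - cnj w * z) \<le> 1 + x * y"
    using norm_triangle_ineq4[of 1 "cnj w * z"] by (simp add: x_def y_def norm_mult)
  then have sq: "(norm (1 - cnj w * z))\<^sup>2 \<le> (1 + x * y)\<^sup>2"
    by (simp add: power_mono)
  have "1 - ((x + y) / (1 + x * y))\<^sup>2 = (1 - x\<^sup>2) * (1 - y\<^sup>2) / (1 + x * y)\<^sup>2"
    using pos by (simp add: power_divide field_simps) (simp add: power2_eq_square algebra_simps)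
  also have "\<dots> \<le> (1 - x\<^sup>2) * (1 - y\<^sup>2) / (norm (1 - cnj w * z))\<^sup>2"
    using xy ne sq pos
    by (intro divide_left_mono mult_nonneg_nonneg mult_pos_pos) (auto simp: power_le_one)
  also have "\<dots> = 1 - (norm (Moebius_function 0 w z))\<^sup>2"
    using one_minus_norm_Moebius_square[OF w z] by (simp add: x_def y_def)
  finally have "(norm (Moebius_function 0 w z))\<^sup>2 \<le> ((x + y) / (1 + x * y))\<^sup>2"
    by simp
  then show ?thesis
    unfolding x_def y_def by (rule power2_le_imp_le) simp
qed

text \<open>This is the triangle inequality for the points \<open>0\<close>, \<open>a\<close>,
  \<open>b\<close>. The point \<open>b\<close> is the image of \<open>v\<close> under the Moebius
  map with parameter \<open>- a\<close>, and \<open>artanh (norm v)\<close> is the distance of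
  \<open>a\<close> and \<open>b\<close>; the bound on \<open>norm b\<close> is then turned into a
  sum by the addition formula.\<close>

lemma artanh_norm_le_add_poincare_dist:
  assumes a: "norm a < 1" and b: "norm b < 1"
  shows "artanh (norm b) \<le> artanh (norm a) + poincare_dist a b"
proof -
  define u where "u = Moebius_function 0 b a"
  have u: "norm u < 1"
    unfolding u_def by (intro Moebius_function_norm_lt_1 a b)
  have u': "norm (Moebius_function 0 a b) = norm u"
  proof -
    have "norm (1 - cnj a * b) = norm (1 - cnj b * a)"
      using complex_mod_cnj[of "1 - cnj b * a"] by (simp add: mult.commute)
    then show ?thesis
      by (simp add: u_def Moebius_function_simple norm_divide norm_minus_commute)
  qed
  define v where "v = Moebius_function 0 a b"
  have v: "norm v < 1"
    using u u' by (simp add: v_def)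
  have "Moebius_function 0 (- a) v = b"
    unfolding v_def using Moebius_function_compose[of "- a" a b] a b by simp
  then have "norm b \<le> (norm a + norm v) / (1 + norm a * norm v)"
    using norm_Moebius_le[of "- a" v] a v by simp
  moreover have "(norm a + norm v) / (1 + norm a * norm v) < 1"
  proof -
    have "0 < (1 - norm a) * (1 - norm v)"
      using a v by simp
    then have "norm a + norm v < 1 + norm a * norm v"
      by (simp add: algebra_simps)
    then show ?thesis
      by (simp add: add_pos_nonneg)
  qed
  moreover have "- 1 < norm b"
    using norm_ge_zero[of b] by linarith
  ultimately have "artanh (norm b) \<le> artanh ((norm a + norm v) / (1 + norm a * norm v))"
    by (intro artanh_real_mono)
  also have "\<dots> = artanh (norm a) + artanh (norm v)"
    using a v by (intro artanh_add_real[symmetric]) auto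
  finally show ?thesis
    by (simp add: poincare_dist_Moebius v_def u' u_def)
qed

lemma poincare_dist_contract:
  assumes "g holomorphic_on unit_disc" "g ` unit_disc \<subseteq> unit_disc" "norm a < 1" "norm b < 1"
  shows "poincare_dist (g a) (g b) \<le> poincare_dist a b"
proof -
  have "- 1 < norm (Moebius_function 0 (g b) (g a))"
    using norm_ge_zero[of "Moebius_function 0 (g b) (g a)"] by linarith
  then show ?thesis
    unfolding poincare_dist_Moebius
    using assms by (intro artanh_real_mono Schwarz_Pick Moebius_function_norm_lt_1)
qed

section \<open>Kobayashi balls and coverings by the disc\<close>

text \<open>The existence of lifts is part of the definition; that \<open>\<phi>\<close> is a topological covering is
  not required.\<close>

definition disc_covering :: "complex set \<Rightarrow> (complex \<Rightarrow> complex) \<Rightarrow> bool" where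
  "disc_covering D \<phi> \<longleftrightarrow>
     \<phi> holomorphic_on unit_disc \<and> \<phi> ` unit_disc = D \<and>
     (\<forall>f a \<zeta>. f holomorphic_on unit_disc \<longrightarrow> f ` unit_disc \<subseteq> D \<longrightarrow> a \<in> unit_disc \<longrightarrow>
        \<zeta> \<in> unit_disc \<longrightarrow> \<phi> \<zeta> = f a \<longrightarrow>
        (\<exists>g. g holomorphic_on unit_disc \<and> g ` unit_disc \<subseteq> unit_disc \<and> g a = \<zeta> \<and>
             (\<forall>x\<in>unit_disc. \<phi> (g x) = f x)))"

text \<open>The chain is lifted disc by disc, beginning at \<open>0\<close>, each lift starting
  where the previous one ended. A lift is a self-map of the disc, hence contracts the Poincare
  distance, so by the triangle inequality the distance from \<open>0\<close> grows by at most one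
  summand per disc.\<close>

lemma disc_chain_lift:
  assumes \<phi>: "disc_covering D \<phi>" and chain: "disc_chain D (\<phi> 0) w N f a b"
  obtains \<zeta> where "norm \<zeta> < 1" "\<phi> \<zeta> = w" "artanh (norm \<zeta>) \<le> (\<Sum>j=1..N. poincare_dist (a j) (b j))"
proof -
  have step: "\<exists>\<zeta>'. norm \<zeta>' < 1 \<and> \<phi> \<zeta>' = f j (b j) \<and>
      artanh (norm \<zeta>') \<le> artanh (norm \<zeta>) + poincare_dist (a j) (b j)"
    if j: "j \<in> {1..N}" and \<zeta>: "norm \<zeta> < 1" "\<phi> \<zeta> = f j (a j)" for j \<zeta>
  proof -
    have fj: "f j holomorphic_on unit_disc" "f j ` unit_disc \<subseteq> D" "a j \<in> unit_disc" "b j \<in> unit_disc"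
      using chain j by (auto simp: disc_chain_def)
    moreover have "\<zeta> \<in> unit_disc"
      using \<zeta> by simp
    ultimately obtain g where g: "g holomorphic_on unit_disc" "g ` unit_disc \<subseteq> unit_disc" "g (a j) = \<zeta>"
        "\<And>x. x \<in> unit_disc \<Longrightarrow> \<phi> (g x) = f j x"
      using \<phi> \<zeta>(2) unfolding disc_covering_def by blast
    have gb: "norm (g (b j)) < 1"
      using g(2) fj(4) by (auto simp: image_subset_iff)
    have "artanh (norm (g (b j))) \<le> artanh (norm \<zeta>) + poincare_dist \<zeta> (g (b j))"
      by (intro artanh_norm_le_add_poincare_dist \<zeta> gb)
    also have "poincare_dist \<zeta> (g (b j)) \<le> poincare_dist (a j) (b j)"
      using poincare_dist_contract[OF g(1,2), of "a j" "b j"] fj g(3) by simp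
    finally show ?thesis
      using gb g(4)[OF fj(4)] by (intro exI[of _ "g (b j)"]) simp
  qed
  have "\<exists>\<zeta>. norm \<zeta> < 1 \<and> \<phi> \<zeta> = f n (b n) \<and>
      artanh (norm \<zeta>) \<le> (\<Sum>j=1..n. poincare_dist (a j) (b j))" if "1 \<le> n" "n \<le> N" for n
    using that
  proof (induction n rule: nat_induct_at_least)
    case base
    then have "1 \<in> {1..N}"
      by simp
    moreover have "\<phi> 0 = f 1 (a 1)"
      using chain by (simp add: disc_chain_def)
    ultimately show ?case
      using step[of 1 0] by simp
  next
    case (Suc n)
    then obtain \<zeta> where \<zeta>: "norm \<zeta> < 1" "\<phi> \<zeta> = f n (b n)"
        "artanh (norm \<zeta>) \<le> (\<Sum>j=1..n. poincare_dist (a j) (b j))"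
      by auto
    have "f n (b n) = f (Suc n) (a (Suc n))"
      using chain Suc by (auto simp: disc_chain_def)
    then obtain \<zeta>' where "norm \<zeta>' < 1" "\<phi> \<zeta>' = f (Suc n) (b (Suc n))"
        "artanh (norm \<zeta>') \<le> artanh (norm \<zeta>) + poincare_dist (a (Suc n)) (b (Suc n))"
      using step[of "Suc n" \<zeta>] \<zeta> Suc.prems by auto
    then show ?case
      using \<zeta>(3) by (intro exI[of _ \<zeta>']) auto
  qed
  moreover have "1 \<le> N" "f N (b N) = w"
    using chain by (auto simp: disc_chain_def)
  ultimately show ?thesis
    using that by blast
qed

lemma kobayashi_ball_subset_covering_image:
  assumes \<phi>: "disc_covering D \<phi>"
  shows "kobayashi_ball D (\<phi> 0) r \<subseteq> \<phi> ` ball 0 (tanh r)"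
proof
  fix w assume "w \<in> kobayashi_ball D (\<phi> 0) r"
  then have w: "w \<in> D" and r: "kobayashi_dist D (\<phi> 0) w < r"
    by (auto simp: kobayashi_ball_def)
  define S where "S = {(\<Sum>j=1..N. poincare_dist (a j) (b j)) |N f a b. disc_chain D (\<phi> 0) w N f a b}"
  obtain \<zeta> where \<zeta>: "\<zeta> \<in> unit_disc" "w = \<phi> \<zeta>"
    using \<phi> w unfolding disc_covering_def by blast
  \<comment> \<open>The covering itself is a chain of one disc. It makes \<open>S\<close> nonempty,
    so that \<open>Inf S < r\<close> yields an actual chain of length below
    \<open>r\<close>.\<close>
  have "disc_chain D (\<phi> 0) w 1 (\<lambda>_. \<phi>) (\<lambda>_. 0) (\<lambda>_. \<zeta>)"
    using \<zeta> \<phi> by (auto simp: disc_chain_def disc_covering_def)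
  then have "S \<noteq> {}"
    unfolding S_def by blast
  moreover have "Inf S < r"
    using r by (simp add: kobayashi_dist_def S_def)
  ultimately obtain s where "s \<in> S" "s < r"
    using cInf_lessD by blast
  then obtain N f a b where chain: "disc_chain D (\<phi> 0) w N f a b"
      and s: "(\<Sum>j=1..N. poincare_dist (a j) (b j)) < r"
    unfolding S_def by blast
  obtain \<xi> where \<xi>: "norm \<xi> < 1" "\<phi> \<xi> = w" "artanh (norm \<xi>) \<le> (\<Sum>j=1..N. poincare_dist (a j) (b j))"
    using disc_chain_lift[OF \<phi> chain] .
  then have "tanh (artanh (norm \<xi>)) < tanh r"
    using s by simp
  moreover have "tanh (artanh (norm \<xi>)) = norm \<xi>"
    using \<xi>(1) norm_ge_zero[of \<xi>] by (intro tanh_artanh_real) linarith+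
  ultimately show "w \<in> \<phi> ` ball 0 (tanh r)"
    using \<xi> by auto
qed

text \<open>The competitor is \<open>\<phi>\<close> precomposed with the scaling by
  \<open>\<rho>\<close>: its image is that of the disc of radius \<open>\<rho>\<close>, which
  contains the Kobayashi ball of radius \<open>artanh \<rho>\<close>.\<close>

lemma fridman_invariant_ge:
  assumes \<phi>: "disc_covering D \<phi>" and \<rho>: "0 < \<rho>" "\<rho> < 1" and inj: "inj_on \<phi> (ball 0 \<rho>)"
  shows "\<rho> \<le> fridman_invariant D (\<phi> 0)"
proof -
  define f where "f = \<phi> \<circ> (\<lambda>\<zeta>. of_real \<rho> * \<zeta>)"
  have th: "tanh (artanh \<rho>) = \<rho>"
    using \<rho> by (intro tanh_artanh_real) auto
  have img: "(\<lambda>\<zeta>. of_real \<rho> * \<zeta>) ` unit_disc = ball 0 \<rho>"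
  proof (intro set_eqI iffI)
    fix x :: complex assume "x \<in> ball 0 \<rho>"
    then have "x = of_real \<rho> * (x / of_real \<rho>)" "x / of_real \<rho> \<in> unit_disc"
      using \<rho> by (auto simp: norm_divide)
    then show "x \<in> (\<lambda>\<zeta>. of_real \<rho> * \<zeta>) ` unit_disc"
      by blast
  qed (use \<rho> in \<open>auto simp: norm_mult\<close>)
  have sub: "ball 0 \<rho> \<subseteq> unit_disc"
    using \<rho> by auto
  have "f holomorphic_on unit_disc"
    unfolding f_def
    by (rule holomorphic_on_compose_gen[of _ _ _ unit_disc])
      (use \<phi> img sub in \<open>auto simp: disc_covering_def intro!: holomorphic_intros\<close>)
  moreover have "inj_on f unit_disc"
    unfolding f_def by (rule comp_inj_on) (use inj \<rho> in \<open>auto simp: img inj_on_def\<close>)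
  moreover have "f ` unit_disc = \<phi> ` ball 0 \<rho>"
    unfolding f_def image_comp[symmetric] img ..
  moreover from this have "f ` unit_disc \<subseteq> D"
    using \<phi> sub by (auto simp: disc_covering_def)
  moreover have "f 0 = \<phi> 0"
    by (simp add: f_def)
  moreover have "kobayashi_ball D (\<phi> 0) (artanh \<rho>) \<subseteq> \<phi> ` ball 0 \<rho>"
    using kobayashi_ball_subset_covering_image[OF \<phi>, of "artanh \<rho>"] by (simp add: th)
  moreover have "artanh \<rho> > 0"
    using th \<rho> by (metis tanh_real_pos_iff)
  ultimately have "f \<in> univalent_maps unit_disc D \<and> f 0 = \<phi> 0 \<and>
      kobayashi_ball D (\<phi> 0) (artanh \<rho>) \<subseteq> f ` unit_disc" "artanh \<rho> > 0"
    by (simp_all add: univalent_maps_def)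
  then have "tanh (artanh \<rho>) \<in> {tanh r |r. r > 0 \<and>
       (\<exists>f\<in>univalent_maps unit_disc D. f 0 = \<phi> 0 \<and> kobayashi_ball D (\<phi> 0) r \<subseteq> f ` unit_disc)}"
    by (intro CollectI exI[of _ "artanh \<rho>"] conjI bexI[of _ f]) simp_all
  moreover have "bdd_above {tanh r |r. r > 0 \<and>
       (\<exists>f\<in>univalent_maps unit_disc D. f 0 = \<phi> 0 \<and> kobayashi_ball D (\<phi> 0) r \<subseteq> f ` unit_disc)}"
    by (rule bdd_aboveI[of _ 1]) (auto intro: less_imp_le tanh_real_lt_1)
  ultimately have "tanh (artanh \<rho>) \<le> fridman_invariant D (\<phi> 0)"
    unfolding fridman_invariant_def by (rule cSup_upper)
  then show ?thesis
    by (simp add: th)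
qed

section \<open>The universal covering of the punctured disc\<close>

text \<open>The Cayley map \<open>\<zeta> \<mapsto> - L (1 + \<zeta>) / (1 - \<zeta>)\<close> onto the left half-plane followed by the
  exponential function, rotated so that \<open>0\<close> is mapped to \<open>z\<close>; here \<open>L = - ln (norm z)\<close>.\<close>

definition punctured_disc_covering :: "complex \<Rightarrow> complex \<Rightarrow> complex" where
  "punctured_disc_covering z \<zeta> = z * exp (2 * of_real (ln (norm z)) * \<zeta> / (1 - \<zeta>))"

lemma punctured_disc_covering_0 [simp]: "punctured_disc_covering z 0 = z"
  by (simp add: punctured_disc_covering_def)

text \<open>The Cayley-type map \<open>\<zeta> \<mapsto> - 2 L \<zeta> / (1 - \<zeta>)\<close> from the disc onto the half-plane
  \<open>Re h < L\<close> and its inverse \<open>h \<mapsto> h / (h - 2 L)\<close>.\<close>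

lemma Re_cayley_less:
  assumes "norm \<zeta> < 1" "L > 0"
  shows "Re (- 2 * of_real L * \<zeta> / (1 - \<zeta>)) < L"
proof -
  have ne: "\<zeta> \<noteq> 1"
    using assms by auto
  \<comment> \<open>This exhibits the map as \<open>L\<close> minus \<open>L\<close> times the
    Cayley map onto the right half-plane.\<close>
  have "- 2 * of_real L * \<zeta> / (1 - \<zeta>) = of_real L - of_real L * ((1 + \<zeta>) / (1 - \<zeta>))"
    using ne by (simp add: field_simps)
  moreover have "Re ((1 + \<zeta>) / (1 - \<zeta>)) > 0"
  proof -
    have "Re ((1 + \<zeta>) / (1 - \<zeta>)) = (1 - (norm \<zeta>)\<^sup>2) / (norm (1 - \<zeta>))\<^sup>2"
      by (simp add: Re_divide cmod_power2) (simp add: power2_eq_square algebra_simps)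
    moreover have "(norm \<zeta>)\<^sup>2 < 1"
      using assms by (simp add: power_less_one_iff)
    ultimately show ?thesis
      using ne by simp
  qed
  then have "0 < L * Re ((1 + \<zeta>) / (1 - \<zeta>))"
    using assms by simp
  ultimately show ?thesis
    by (simp only: minus_complex.sel Re_complex_of_real times_complex.sel Im_complex_of_real)
qed

lemma norm_cayley_inverse_less:
  assumes "Re h < L" "L > 0"
  shows "h \<noteq> 2 * of_real L" "norm (h / (h - 2 * of_real L)) < 1"
    "- 2 * of_real L * (h / (h - 2 * of_real L)) / (1 - h / (h - 2 * of_real L)) = h"
proof -
  show ne: "h \<noteq> 2 * of_real L"
    using assms by auto
  \<comment> \<open>The line \<open>Re h = L\<close> is the perpendicular bisector of
    \<open>0\<close> and \<open>2 * L\<close>, so points to its left are closer to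
    \<open>0\<close>.\<close>
  have "(norm (h - 2 * of_real L))\<^sup>2 - (norm h)\<^sup>2 = 4 * L * (L - Re h)"
    by (simp add: cmod_power2) (simp add: power2_eq_square algebra_simps)
  moreover have "4 * L * (L - Re h) > 0"
    using assms by simp
  ultimately have "(norm h)\<^sup>2 < (norm (h - 2 * of_real L))\<^sup>2"
    by linarith
  then have "norm h < norm (h - 2 * of_real L)"
    by (rule power2_less_imp_less) simp
  then show "norm (h / (h - 2 * of_real L)) < 1"
    using ne by (simp add: norm_divide)
  have "1 - h / (h - 2 * of_real L) = - 2 * of_real L / (h - 2 * of_real L)"
    using ne by (simp add: field_simps)
  then show "- 2 * of_real L * (h / (h - 2 * of_real L)) / (1 - h / (h - 2 * of_real L)) = h"
    using ne assms by simp
qed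

lemma cayley_inverse:
  fixes \<zeta> :: complex
  assumes "norm \<zeta> < 1" "L > 0" "h = - 2 * of_real L * \<zeta> / (1 - \<zeta>)"
  shows "h / (h - 2 * of_real L) = \<zeta>"
proof -
  have "\<zeta> \<noteq> 1"
    using assms by auto
  then have "h - 2 * of_real L = - 2 * of_real L / (1 - \<zeta>)"
    unfolding assms(3) by (simp add: field_simps)
  then show ?thesis
    using \<open>\<zeta> \<noteq> 1\<close> assms by simp
qed

text \<open>The covering is \<open>z * exp (H \<zeta>)\<close> with \<open>H\<close> a bijection
  from the disc onto the half-plane \<open>Re h < L\<close>. Since the disc is simply connected,
  \<open>f x / z\<close> has a holomorphic logarithm there; composing a suitable branch with the
  inverse \<open>G\<close> of \<open>H\<close> gives the lift.\<close>

lemma disc_covering_punctured_disc: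
  assumes z: "z \<in> punctured_disc"
  shows "disc_covering punctured_disc (punctured_disc_covering z)"
proof -
  define L where "L = - ln (norm z)"
  have L: "L > 0" and z0: "z \<noteq> 0" and nz: "norm z = exp (- L)"
    using z by (auto simp: punctured_disc_def L_def)
  define H :: "complex \<Rightarrow> complex" where "H \<zeta> = - 2 * of_real L * \<zeta> / (1 - \<zeta>)" for \<zeta>
  define G :: "complex \<Rightarrow> complex" where "G h = h / (h - 2 * of_real L)" for h
  have \<phi>: "punctured_disc_covering z \<zeta> = z * exp (H \<zeta>)" for \<zeta>
    by (simp add: punctured_disc_covering_def H_def L_def)
  have norm_less: "norm (z * exp h) < 1 \<longleftrightarrow> Re h < L" for h
    by (simp add: norm_mult nz flip: exp_add)
  have GH: "norm (G h) < 1" "H (G h) = h" if "Re h < L" for h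
    using norm_cayley_inverse_less[OF that L] by (simp_all add: G_def H_def)
  have "punctured_disc_covering z holomorphic_on unit_disc"
    unfolding punctured_disc_covering_def by (intro holomorphic_intros) auto
  moreover have "punctured_disc_covering z ` unit_disc = punctured_disc"
  proof (intro set_eqI iffI)
    fix w assume "w \<in> punctured_disc_covering z ` unit_disc"
    then show "w \<in> punctured_disc"
      using Re_cayley_less[OF _ L] z0 by (auto simp: punctured_disc_def \<phi> norm_less H_def)
  next
    fix w assume w: "w \<in> punctured_disc"
    define h where "h = Ln (w / z)"
    have eq: "w = z * exp h"
      using w z0 by (simp add: h_def punctured_disc_def)
    then have "Re h < L"
      using w norm_less[of h] by (simp add: punctured_disc_def)
    from GH[OF this] have "w = punctured_disc_covering z (G h)" "G h \<in> unit_disc"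
      by (auto simp: \<phi> eq)
    then show "w \<in> punctured_disc_covering z ` unit_disc"
      by blast
  qed
  moreover have "\<exists>g. g holomorphic_on unit_disc \<and> g ` unit_disc \<subseteq> unit_disc \<and> g a = \<zeta> \<and>
      (\<forall>x\<in>unit_disc. punctured_disc_covering z (g x) = f x)"
    if f: "f holomorphic_on unit_disc" "f ` unit_disc \<subseteq> punctured_disc"
      and a: "a \<in> unit_disc" and \<zeta>: "\<zeta> \<in> unit_disc" and eq: "punctured_disc_covering z \<zeta> = f a"
    for f a \<zeta>
  proof -
    have fp: "f x \<noteq> 0" "norm (f x) < 1" if "x \<in> unit_disc" for x
      using f(2) that by (auto simp: punctured_disc_def image_subset_iff)
    have "(\<lambda>x. f x / z) holomorphic_on unit_disc"
      by (intro holomorphic_intros f z0)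
    moreover have "f x / z \<noteq> 0" if "x \<in> unit_disc" for x
      using fp(1)[OF that] z0 by simp
    ultimately obtain h0 where h0: "h0 holomorphic_on unit_disc"
        "\<And>x. x \<in> unit_disc \<Longrightarrow> exp (h0 x) = f x / z"
      using holomorphic_logarithm_exists[of unit_disc "\<lambda>x. f x / z" 0] by auto
    \<comment> \<open>The added constant is a period of \<open>exp\<close>; it selects the branch
      with \<open>h a = H \<zeta>\<close>, so that the lift takes the prescribed value at
      \<open>a\<close>.\<close>
    define h where "h x = h0 x + (H \<zeta> - h0 a)" for x
    have "exp (H \<zeta>) = exp (h0 a)"
      using h0(2)[OF a] eq[symmetric] z0 by (simp add: \<phi>)
    then have fh: "f x = z * exp (h x)" if "x \<in> unit_disc" for x
      using h0(2)[OF that] z0 by (simp add: h_def exp_add exp_diff)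
    have Re: "Re (h x) < L" if "x \<in> unit_disc" for x
      using fp(2)[OF that] fh[OF that] norm_less[of "h x"] by simp
    have "(\<lambda>x. G (h x)) holomorphic_on unit_disc"
      unfolding G_def h_def
      by (intro holomorphic_intros h0) (use norm_cayley_inverse_less(1)[OF Re L] in \<open>auto simp: h_def\<close>)
    moreover have "(\<lambda>x. G (h x)) ` unit_disc \<subseteq> unit_disc"
      using GH(1)[OF Re] by auto
    moreover have "G (h a) = \<zeta>"
      unfolding G_def by (rule cayley_inverse[OF _ L]) (use \<zeta> in \<open>auto simp: h_def H_def\<close>)
    moreover have "\<forall>x\<in>unit_disc. punctured_disc_covering z (G (h x)) = f x"
      using GH(2)[OF Re] fh by (auto simp: \<phi>)
    ultimately show ?thesis
      by (intro exI[of _ "\<lambda>x. G (h x)"]) blast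
  qed
  ultimately show ?thesis
    unfolding disc_covering_def by blast
qed

text \<open>For \<open>norm x < 1 / L\<close> and \<open>L \<ge> 3\<close> the numerator of
  \<open>H x\<close> has modulus below 2 and the denominator above 2/3. Hence
  \<open>norm (H x) < 3 < pi\<close>, so the values of \<open>H\<close> lie in a strip on which
  \<open>exp\<close> is injective, and \<open>H\<close> itself is inverted by
  \<open>cayley_inverse\<close>.\<close>

lemma inj_on_punctured_disc_covering:
  assumes z: "z \<noteq> 0" and L: "L = - ln (norm z)" "L \<ge> 3"
  shows "inj_on (punctured_disc_covering z) (ball 0 (1 / L))"
proof (rule inj_onI)
  define H :: "complex \<Rightarrow> complex" where "H \<zeta> = - 2 * of_real L * \<zeta> / (1 - \<zeta>)" for \<zeta>
  have small: "\<bar>Im (H x)\<bar> < pi" if "x \<in> ball 0 (1 / L)" for x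
  proof -
    have x: "norm x * L < 1"
      using that L by (simp add: field_simps)
    then have x3: "norm x < 1 / 3"
      using mult_left_mono[of 3 L "norm x"] L by simp
    have "norm (1 - x) \<ge> 1 - norm x"
      using norm_triangle_ineq2[of 1 x] by simp
    then have "norm (1 - x) > 2 / 3"
      using x3 by linarith
    then have "norm (H x) < 2 / (2 / 3)"
      unfolding H_def norm_divide norm_mult
      using x \<open>norm (1 - x) > 2 / 3\<close> L(2) by (intro frac_less) (auto simp: mult.commute)
    also have "\<dots> < pi"
      using pi_gt3 by simp
    finally show ?thesis
      using abs_Im_le_cmod[of "H x"] by linarith
  qed
  fix x y assume x: "x \<in> ball 0 (1 / L)" and y: "y \<in> ball 0 (1 / L)"
    and eq: "punctured_disc_covering z x = punctured_disc_covering z y"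
  have "punctured_disc_covering z \<zeta> = z * exp (H \<zeta>)" for \<zeta>
    by (simp add: punctured_disc_covering_def H_def L(1))
  with eq have exp_eq: "exp (H x) = exp (H y)"
    using z by simp
  have "\<bar>Im (H x) - Im (H y)\<bar> < 2 * pi"
    using small[OF x] small[OF y] by linarith
  then have Heq: "H x = H y"
    using exp_eq by (rule exp_complex_eqI)
  have "1 / L < 1" "L > 0"
    using L(2) by simp_all
  moreover have "norm x < 1 / L" "norm y < 1 / L"
    using x y by simp_all
  ultimately have "norm x < 1" "norm y < 1" "L > 0"
    by linarith+
  then have "H x / (H x - 2 * of_real L) = x" "H y / (H y - 2 * of_real L) = y"
    by (simp_all only: cayley_inverse[OF _ _ H_def])
  then show "x = y"
    by (metis Heq)
qed

section \<open>The squeezing function of the punctured disc\<close>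

lemma punctured_disc_eq: "punctured_disc = unit_disc - {0}"
  by (auto simp: punctured_disc_def)

text \<open>If \<open>g p = g w\<close>, the open mapping theorem makes the images of disjoint
  neighbourhoods of \<open>p\<close> and \<open>w\<close> overlap in an open set, so some value near
  \<open>g p\<close> is taken twice away from \<open>p\<close>.\<close>

lemma univalent_extension_omits_value:
  assumes S: "open S" "connected S" "p \<in> S" and g: "g holomorphic_on S"
    and inj: "inj_on g (S - {p})" and w: "w \<in> S - {p}"
  shows "g p \<noteq> g w"
proof
  assume eq: "g p = g w"
  obtain U V where UV: "open U" "open V" "p \<in> U" "w \<in> V" "U \<inter> V = {}"
    using hausdorff[of p w] w by auto
  \<comment> \<open>For a constant \<open>g\<close>, injectivity off \<open>p\<close> would leave
    only the two points \<open>p\<close> and \<open>w\<close> in the open set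
    \<open>S\<close>.\<close>
  have nonconst: "\<not> g constant_on S"
  proof
    assume "g constant_on S"
    then have "g x = g y" if "x \<in> S" "y \<in> S" for x y
      using that unfolding constant_on_def by metis
    then have "x = w" if "x \<in> S - {p}" for x
      using inj_onD[OF inj _ that w] that w by blast
    then have "S = {p, w}"
      using w S by blast
    then show False
      using finite_imp_not_open[of S] \<open>open S\<close> by simp
  qed
  have "open (g ` (U \<inter> S))" "open (g ` (V \<inter> S))"
    using UV S by (auto intro!: open_mapping_thm[OF g S(1,2) _ _ nonconst])
  then have "open (g ` (U \<inter> S) \<inter> g ` (V \<inter> S))"
    by blast
  moreover have "g p \<in> g ` (U \<inter> S) \<inter> g ` (V \<inter> S)"
    using UV S w by (intro IntI image_eqI[of _ _ p] image_eqI[of _ _ w]) (auto simp: eq)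
  \<comment> \<open>A singleton is not open, so the overlap contains a value other than
    \<open>g p\<close>. Its preimage in \<open>U\<close> is then not \<open>p\<close>, and its
    preimage in \<open>V\<close> is not \<open>p\<close> because \<open>V\<close> misses
    \<open>U\<close>.\<close>
  ultimately obtain q where q: "q \<in> g ` (U \<inter> S) \<inter> g ` (V \<inter> S)" "q \<noteq> g p"
    using not_open_singleton[of "g p"] by (metis subsetI subset_singletonD empty_iff singleton_iff)
  then obtain u v where "u \<in> U" "u \<in> S" "v \<in> V" "v \<in> S" "q = g u" "q = g v"
    by auto
  moreover have "u \<noteq> p" "v \<noteq> p"
    using calculation q UV by auto
  ultimately show False
    using inj_onD[OF inj, of u v] UV by auto
qed

lemma univalent_punctured_disc_radius_le:
  assumes f: "f \<in> univalent_maps punctured_disc unit_disc" and z: "z \<in> punctured_disc"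
    and fz: "f z = 0" and r: "ball 0 r \<subseteq> f ` punctured_disc"
  shows "r \<le> norm z"
proof -
  have hol: "f holomorphic_on unit_disc - {0}" and inj: "inj_on f (unit_disc - {0})"
    and im: "f ` (unit_disc - {0}) \<subseteq> unit_disc"
    using f by (auto simp: univalent_maps_def punctured_disc_eq)
  have bd: "norm (f x) < 1" if "x \<in> unit_disc - {0}" for x
    using im that by (auto simp: image_subset_iff)
  have "eventually (\<lambda>x. norm (f x) \<le> 1) (at 0)"
    unfolding eventually_at by (intro exI[of _ 1]) (use bd in \<open>force intro: less_imp_le\<close>)
  then obtain g where g: "g holomorphic_on unit_disc" and gf: "\<And>x. x \<in> unit_disc - {0} \<Longrightarrow> g x = f x"
    using holomorphic_on_extend_bounded[OF hol] by auto
  have injg: "inj_on g (unit_disc - {0})"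
    using inj gf by (auto simp: inj_on_def)
  have omit: "g 0 \<noteq> g w" if "w \<in> unit_disc - {0}" for w
    by (rule univalent_extension_omits_value[OF _ _ _ g injg that]) auto
  have z': "z \<in> unit_disc - {0}"
    using z by (simp add: punctured_disc_eq)
  \<comment> \<open>Otherwise \<open>norm g\<close> would attain its maximum at the interior point
    \<open>0\<close>, forcing \<open>g\<close> to be constant, although \<open>g 0\<close> differs
    from \<open>g z\<close>.\<close>
  have g0: "norm (g 0) < 1"
  proof (rule ccontr)
    assume "\<not> norm (g 0) < 1"
    then have "norm (g x) \<le> norm (g 0)" if "x \<in> unit_disc" for x
      using bd[of x] gf[of x] that by (cases "x = 0") auto
    then have "g constant_on unit_disc"
      by (intro maximum_modulus_principle[OF g, of unit_disc 0]) auto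
    then show False
      using omit[OF z'] z' unfolding constant_on_def by auto
  qed
  have gim: "g ` unit_disc \<subseteq> unit_disc"
  proof (intro image_subsetI)
    fix x assume "x \<in> unit_disc"
    then show "g x \<in> unit_disc"
      using g0 bd[of x] gf[of x] by (cases "x = 0") auto
  qed
  have "g z = 0"
    using gf z' fz by simp
  then have "norm (g 0) \<le> norm z"
    using Schwarz_Pick[OF g gim, of 0 z] z' by (simp add: Moebius_function_simple)
  moreover have "g 0 \<notin> f ` punctured_disc"
    using omit gf unfolding punctured_disc_eq by force
  then have "r \<le> norm (g 0)"
    using r by (meson mem_ball_0 not_le subsetD)
  ultimately show ?thesis
    by simp
qed

text \<open>This is the extremal map: as an automorphism of the disc it sends \<open>0\<close> to
  \<open>- z\<close>, so on the punctured disc it omits only that value, whose modulus is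
  \<open>norm z\<close>.\<close>

lemma Moebius_function_univalent_punctured_disc:
  assumes z: "z \<in> punctured_disc"
  shows "Moebius_function 0 z \<in> univalent_maps punctured_disc unit_disc"
    "ball 0 (norm z) \<subseteq> Moebius_function 0 z ` punctured_disc"
proof -
  have nz: "norm z < 1"
    using z by (simp add: punctured_disc_def)
  have inv: "Moebius_function 0 (- z) (Moebius_function 0 z x) = x" if "norm x < 1" for x :: complex
    using Moebius_function_compose[of "- z" z x] nz that by simp
  have inv': "Moebius_function 0 z (Moebius_function 0 (- z) x) = x" if "norm x < 1" for x :: complex
    using Moebius_function_compose[of z "- z" x] nz that by simp
  have "inj_on (Moebius_function 0 z) punctured_disc"
    by (rule inj_on_inverseI[of _ "Moebius_function 0 (- z)"]) (simp add: inv punctured_disc_def)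
  moreover have "Moebius_function 0 z holomorphic_on punctured_disc"
    using Moebius_function_holomorphic[OF nz] by (rule holomorphic_on_subset) (auto simp: punctured_disc_def)
  moreover have "Moebius_function 0 z ` punctured_disc \<subseteq> unit_disc"
    using Moebius_function_norm_lt_1[OF nz] by (auto simp: punctured_disc_def)
  ultimately show "Moebius_function 0 z \<in> univalent_maps punctured_disc unit_disc"
    by (simp add: univalent_maps_def)
  show "ball 0 (norm z) \<subseteq> Moebius_function 0 z ` punctured_disc"
  proof
    fix x :: complex assume x: "x \<in> ball 0 (norm z)"
    define y where "y = Moebius_function 0 (- z) x"
    have x1: "norm x < 1"
      using x nz by simp
    have "norm y < 1"
      unfolding y_def using Moebius_function_norm_lt_1[of "- z" x] nz x1 by simp
    moreover have xy: "x = Moebius_function 0 z y"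
      using inv'[OF x1] by (simp add: y_def)
    moreover have "y \<noteq> 0"
      using x xy by (auto simp: Moebius_function_of_zero)
    ultimately show "x \<in> Moebius_function 0 z ` punctured_disc"
      by (auto simp: punctured_disc_def)
  qed
qed

lemma squeezing_function_punctured_disc:
  assumes z: "z \<in> punctured_disc"
  shows "squeezing_function punctured_disc z = norm z"
  unfolding squeezing_function_def
proof (rule cSup_eq_maximum)
  show "norm z \<in> {r. r > 0 \<and> (\<exists>f\<in>univalent_maps punctured_disc unit_disc.
      f z = 0 \<and> ball 0 r \<subseteq> f ` punctured_disc)}"
    using Moebius_function_univalent_punctured_disc[OF z] z Moebius_function_eq_zero[of 0 z]
    by (auto simp: punctured_disc_def)
qed (use univalent_punctured_disc_radius_le z in blast)

section \<open>The quotient invariant\<close>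

lemma quotient_invariant_punctured_disc_bounds:
  assumes z: "z \<noteq> 0" "norm z < exp (- 3)"
  shows "0 \<le> quotient_invariant punctured_disc z"
    "quotient_invariant punctured_disc z \<le> norm z * ln (1 / norm z)"
proof -
  define L where "L = - ln (norm z)"
  \<comment> \<open>The threshold \<open>exp (- 3)\<close> is chosen to give \<open>L > 3\<close>,
    as the injectivity of the covering on the disc of radius \<open>1 / L\<close> requires.\<close>
  have "ln (norm z) < - 3"
    using z ln_less_cancel_iff[of "norm z" "exp (- 3)"] by simp
  then have L: "L > 3"
    by (simp add: L_def)
  have "norm z < 1"
    using z(2) by (rule less_trans) simp
  then have pz: "z \<in> punctured_disc"
    using z by (simp add: punctured_disc_def)
  have e: "1 / L \<le> fridman_invariant punctured_disc z"
    using fridman_invariant_ge[OF disc_covering_punctured_disc[OF pz], of "1 / L"]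
      inj_on_punctured_disc_covering[OF z(1) L_def] L by simp
  have pos: "0 < 1 / L"
    using L by simp
  then have "0 < fridman_invariant punctured_disc z"
    using e by linarith
  then show "0 \<le> quotient_invariant punctured_disc z"
    by (simp add: quotient_invariant_def squeezing_function_punctured_disc[OF pz])
  have "quotient_invariant punctured_disc z \<le> norm z / (1 / L)"
    unfolding quotient_invariant_def squeezing_function_punctured_disc[OF pz]
    using e pos \<open>0 < fridman_invariant punctured_disc z\<close>
    by (intro divide_left_mono mult_pos_pos) auto
  then show "quotient_invariant punctured_disc z \<le> norm z * ln (1 / norm z)"
    using z by (simp add: L_def ln_div)
qed

theorem theorem6:
  shows "(\<exists>\<delta>>0. \<forall>z. 0 < norm z \<and> norm z < \<delta> \<longrightarrow> quotient_invariant punctured_disc z < 1) \<and>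
    (quotient_invariant punctured_disc \<longlongrightarrow> 0) (at 0)"
proof
  have "quotient_invariant punctured_disc z < 1" if z: "0 < norm z" "norm z < exp (- 3)" for z
  proof -
    \<comment> \<open>Multiplied by \<open>norm z\<close>, this puts the upper bound for the
      quotient strictly below 1.\<close>
    have "ln (1 / norm z) < 1 / norm z"
      using z by (intro ln_less_self) simp
    then have "norm z * ln (1 / norm z) < 1"
      using z by (simp add: field_simps)
    then show ?thesis
      using quotient_invariant_punctured_disc_bounds(2)[of z] z by simp
  qed
  then show "\<exists>\<delta>>0. \<forall>z. 0 < norm z \<and> norm z < \<delta> \<longrightarrow> quotient_invariant punctured_disc z < 1"
    by (intro exI[of _ "exp (- 3)"]) auto
  have ev: "eventually (\<lambda>z::complex. z \<noteq> 0 \<and> norm z < exp (- 3)) (at 0)"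
    unfolding eventually_at by (intro exI[of _ "exp (- 3)"]) auto
  show "(quotient_invariant punctured_disc \<longlongrightarrow> 0) (at 0)"
  proof (rule tendsto_sandwich)
    show "eventually (\<lambda>z. 0 \<le> quotient_invariant punctured_disc z) (at 0)"
      using ev by eventually_elim (simp add: quotient_invariant_punctured_disc_bounds)
    show "eventually (\<lambda>z. quotient_invariant punctured_disc z \<le> norm z * ln (1 / norm z)) (at 0)"
      using ev by eventually_elim (intro quotient_invariant_punctured_disc_bounds(2); simp)
    have "((\<lambda>x::real. x * ln (1 / x)) \<longlongrightarrow> 0) (at_right 0)"
      by real_asymp
    moreover have "filterlim norm (at_right 0) (at (0::complex))"
      unfolding filterlim_at by (auto simp: eventually_at_filter intro!: tendsto_eq_intros)
    ultimately show "((\<lambda>z::complex. norm z * ln (1 / norm z)) \<longlongrightarrow> 0) (at 0)"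
      by (rule filterlim_compose)
  qed simp
qed

end
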